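(* Let $G$ be a finite abelian group, and let $k\geq 1$, $r\geq 2$ be integers. Let $\Omega(s_{k\exp(G)}(G))$ denote the least positive integer $n$ such that $\binom{n-1}{r-1}\geq s_{k\exp(G)}(G)$. Then $$\Omega(s_{k\exp(G)}(G))-1\leq R(\mathcal{I}_{k\exp(G)}^{(r)},G)\leq R(\mathcal{S}_{k\exp(G)}^{(r)},G)\leq \Omega(s_{k\exp(G)}(G)).$$ In particular, if $r$ divides $\Omega(s_{k\exp(G)}(G))-1$, then $R(\mathcal{I}_{k\exp(G)}^{(r)},G)=R(\mathcal{S}_{k\exp(G)}^{(r)},G)=\Omega(s_{k\exp(G)}(G))$.
   Context: $\exp(G)$ is the exponent of $G$. For a positive integer $m$ with $\exp(G)\mid m$, $s_m(G)$ is the smallest positive integer $d$ such that every sequence of $d$ elements of $G$ contains a subsequence of length $m$ whose sum is $0$ in $G$. $K_d^{(r)}$ denotes the complete $r$-uniform hypergraph on $d$ vertices (its edges are all $r$-element subsets of a $d$-element vertex set). A $G$-coloring of $K_d^{(r)}$ is any map $c$ from its edge set to $G$. An intersecting family is a set of edges any two of which have nonempty intersection; a hyperstar is a set of edges whose total intersection is nonempty. $\mathcal{I}_m^{(r)}$ (resp. $\mathcal{S}_m^{(r)}$) is the collection of all $r$-uniform intersecting families (resp. hyperstars) with $m$ edges. For such a collection $\mathcal{F}$, $R(\mathcal{F},G)$ is the smallest positive integer $d$ such that for every $G$-coloring $c$ of $K_d^{(r)}$ there is a set $E'$ of edges of $K_d^{(r)}$ forming a copy of some member of $\mathcal{F}$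 with $\sum_{e\in E'}c(e)=0$. *)

theory Defs
  imports "HOL-Algebra.Multiplicative_Group"
begin

text \<open>Abelian groups are written multiplicatively, as in \<^locale>\<open>comm_group\<close>: a sum in the group
  is a \<^const>\<open>finprod\<close>, and ``zero-sum'' means that this product is the neutral element.\<close>

definition group_exponent :: "('a, 'b) monoid_scheme \<Rightarrow> nat" where
  "group_exponent G = (LEAST n. n > 0 \<and> (\<forall>x\<in>carrier G. x [^]\<^bsub>G\<^esub> n = \<one>\<^bsub>G\<^esub>))"

text \<open>Subsequences are given by index sets, so repeated values count with multiplicity.\<close>

definition forces_zero_sum_subseq :: "('a, 'b) monoid_scheme \<Rightarrow> nat \<Rightarrow> nat \<Rightarrow> bool" where
  "forces_zero_sum_subseq G m d \<longleftrightarrow>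
    (\<forall>a \<in> {..<d} \<rightarrow> carrier G. \<exists>I \<subseteq> {..<d}. card I = m \<and> finprod G a I = \<one>\<^bsub>G\<^esub>)"

definition zero_sum_const :: "nat \<Rightarrow> ('a, 'b) monoid_scheme \<Rightarrow> nat" where
  "zero_sum_const m G = (LEAST d. d > 0 \<and> forces_zero_sum_subseq G m d)"

definition complete_hypergraph :: "nat \<Rightarrow> nat \<Rightarrow> nat set set" where
  "complete_hypergraph r d = {e. e \<subseteq> {..<d} \<and> card e = r}"

text \<open>Hypergraphs are identified with their edge sets. Since only finite hypergraphs up to
  isomorphism matter, natural numbers suffice as vertices.\<close>

definition intersecting_families :: "nat \<Rightarrow> nat \<Rightarrow> nat set set set" where
  "intersecting_families r m =
    {F. finite F \<and> card F = m \<and> (\<forall>e\<in>F. card e = r) \<and> (\<forall>e\<in>F. \<forall>f\<in>F. e \<inter> f \<noteq> {})}"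

definition hyperstars :: "nat \<Rightarrow> nat \<Rightarrow> nat set set set" where
  "hyperstars r m = {F. finite F \<and> card F = m \<and> (\<forall>e\<in>F. card e = r) \<and> \<Inter>F \<noteq> {}}"

definition is_copy_of :: "nat set set \<Rightarrow> nat set set \<Rightarrow> bool" where
  "is_copy_of E F \<longleftrightarrow> (\<exists>\<phi>. inj_on \<phi> (\<Union>F) \<and> E = (\<lambda>e. \<phi> ` e) ` F)"

definition forces_zero_sum_copy ::
    "nat \<Rightarrow> nat set set set \<Rightarrow> ('a, 'b) monoid_scheme \<Rightarrow> nat \<Rightarrow> bool" where
  "forces_zero_sum_copy r \<F> G d \<longleftrightarrow>
    (\<forall>c \<in> complete_hypergraph r d \<rightarrow> carrier G.
      \<exists>E \<subseteq> complete_hypergraph r d.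
        (\<exists>F\<in>\<F>. is_copy_of E F) \<and> finprod G c E = \<one>\<^bsub>G\<^esub>)"

definition zero_sum_ramsey ::
    "nat \<Rightarrow> nat set set set \<Rightarrow> ('a, 'b) monoid_scheme \<Rightarrow> nat" where
  "zero_sum_ramsey r \<F> G = (LEAST d. d > 0 \<and> forces_zero_sum_copy r \<F> G d)"

definition Omega :: "nat \<Rightarrow> nat \<Rightarrow> nat" where
  "Omega r s = (LEAST n. n > 0 \<and> (n - 1) choose (r - 1) \<ge> s)"

text \<open>The minima above are attained in the situations of interest, so none of the \<open>LEAST\<close>
  terms is a junk value there.\<close>

lemma group_exponent_works:
  fixes G (structure)
  assumes "comm_group G" "finite (carrier G)"
  shows "group_exponent G > 0 \<and> (\<forall>x\<in>carrier G. x [^] group_exponent G = \<one>)"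
proof -
  interpret comm_group G by fact
  have "order G > 0" using assms(2) order_gt_0_iff_finite by blast
  moreover have "\<forall>x\<in>carrier G. x [^] order G = \<one>"
    using pow_order_eq_1 by blast
  ultimately show ?thesis
    unfolding group_exponent_def
    by (intro LeastI[of "\<lambda>n. n > 0 \<and> (\<forall>x\<in>carrier G. x [^] n = \<one>)" "order G"]) auto
qed

lemma zero_sum_const_works:
  fixes G (structure)
  assumes "comm_group G" "finite (carrier G)" "m = k * group_exponent G"
  shows "zero_sum_const m G > 0 \<and> forces_zero_sum_subseq G m (zero_sum_const m G)"
proof -
  interpret comm_group G by fact
  define d where "d = Suc (m * card (carrier G))"
  have pow: "x [^] m = \<one>" if "x \<in> carrier G" for x
  proof -
    have "x [^] m = (x [^] group_exponent G) [^] k"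
      using nat_pow_pow[OF that, of "group_exponent G" k] by (simp add: assms(3) mult.commute)
    then show ?thesis using group_exponent_works[OF assms(1,2)] that by simp
  qed
  have "\<exists>I \<subseteq> {..<d}. card I = m \<and> finprod G a I = \<one>" if a: "a \<in> {..<d} \<rightarrow> carrier G" for a
  proof -
    have "\<exists>x\<in>carrier G. m \<le> card {i\<in>{..<d}. a i = x}"
    proof (rule ccontr)
      assume "\<not> ?thesis"
      then have le: "\<And>x. x \<in> carrier G \<Longrightarrow> card {i\<in>{..<d}. a i = x} \<le> m" by force
      have "{..<d} = (\<Union>x\<in>carrier G. {i\<in>{..<d}. a i = x})" using a by auto
      then have "d \<le> (\<Sum>x\<in>carrier G. card {i\<in>{..<d}. a i = x})"
        using card_UN_le[OF assms(2), of "\<lambda>x. {i\<in>{..<d}. a i = x}"] by (metis card_lessThan)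
      also have "\<dots> \<le> of_nat (card (carrier G)) * m"
        by (rule sum_bounded_above) (rule le)
      finally show False by (simp add: d_def mult.commute)
    qed
    then obtain x where x: "x \<in> carrier G" "m \<le> card {i\<in>{..<d}. a i = x}" by blast
    obtain I where I: "I \<subseteq> {i\<in>{..<d}. a i = x}" "card I = m"
      using obtain_subset_with_card_n[OF x(2)] by metis
    have "finprod G a I = finprod G (\<lambda>_. x) I"
      by (rule finprod_cong') (use I x in auto)
    also have "\<dots> = \<one>" using finprod_const[OF x(1), of I] pow[OF x(1)] I(2) by simp
    finally show ?thesis using I by auto
  qed
  then have "d > 0 \<and> forces_zero_sum_subseq G m d"
    by (auto simp: forces_zero_sum_subseq_def d_def)
  then show ?thesis unfolding zero_sum_const_def by (rule LeastI)
qed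

lemma Omega_works:
  assumes "r \<ge> 2"
  shows "Omega r s > 0 \<and> (Omega r s - 1) choose (r - 1) \<ge> s"
proof -
  obtain q where q: "r - 1 = Suc q" using assms by (cases "r - 1") auto
  have "s \<le> (s + q) choose Suc q"
  proof (induction s)
    case (Suc s)
    have "Suc s + q choose Suc q = (s + q choose q) + (s + q choose Suc q)" by simp
    moreover have "s + q choose q > 0" by simp
    ultimately show ?case using Suc.IH by linarith
  qed simp
  then have "Suc (s + q) > 0 \<and> (Suc (s + q) - 1) choose (r - 1) \<ge> s"
    using q by simp
  then show ?thesis unfolding Omega_def by (rule LeastI)
qed

lemma forces_zero_sum_hyperstar:
  fixes G (structure)
  assumes "comm_group G" "finite (carrier G)" "m = k * group_exponent G" "r \<ge> 2"
  shows "forces_zero_sum_copy r (hyperstars r m) G (Omega r (zero_sum_const m G))"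
  unfolding forces_zero_sum_copy_def
proof
  interpret comm_group G by fact
  define s where "s = zero_sum_const m G"
  define d where "d = Omega r (zero_sum_const m G)"
  fix c assume c: "c \<in> complete_hypergraph r (Omega r (zero_sum_const m G)) \<rightarrow> carrier G"
  define L where "L = {f. f \<subseteq> {1..<d} \<and> card f = r - 1}"
  have d: "d > 0" "s \<le> (d - 1) choose (r - 1)"
    using Omega_works[OF assms(4)] by (auto simp: d_def s_def)
  have "card L = (d - 1) choose (r - 1)"
    using n_subsets[of "{1..<d}" "r - 1"] by (simp add: L_def)
  with d(2) have "s \<le> card L" by simp
  then obtain L' where L': "L' \<subseteq> L" "card L' = s" "finite L'"
    by (rule obtain_subset_with_card_n)
  then obtain g where g: "bij_betw g {..<s} L'"
    using ex_bij_betw_nat_finite[OF L'(3)] by (auto simp: atLeast0LessThan)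
  define h where "h i = insert 0 (g i)" for i
  have gL: "g i \<in> L" if "i < s" for i
    using g L'(1) that by (auto simp: bij_betw_def)
  have inj: "inj_on h {..<s}"
  proof (rule inj_onI)
    fix i j assume ij: "i \<in> {..<s}" "j \<in> {..<s}" "h i = h j"
    have "0 \<notin> g i" "0 \<notin> g j" using gL[of i] gL[of j] ij by (auto simp: L_def)
    then have "g i = g j" using ij(3) by (simp add: h_def insert_ident)
    then show "i = j" using g ij by (auto simp: bij_betw_def inj_on_def)
  qed
  have hK: "h i \<in> complete_hypergraph r d" if "i < s" for i
  proof -
    have "g i \<subseteq> {1..<d}" "card (g i) = r - 1" using gL[OF that] by (auto simp: L_def)
    moreover from this have "finite (g i)" "0 \<notin> g i"
      by (auto intro: finite_subset)
    ultimately show ?thesis using d(1) assms(4)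
      by (auto simp: h_def complete_hypergraph_def)
  qed
  have cc: "c \<in> complete_hypergraph r d \<rightarrow> carrier G" using c by (simp add: d_def)
  have "(\<lambda>i. c (h i)) \<in> {..<s} \<rightarrow> carrier G" using cc hK by auto
  then obtain I where I: "I \<subseteq> {..<s}" "card I = m" "finprod G (\<lambda>i. c (h i)) I = \<one>"
    using zero_sum_const_works[OF assms(1-3)]
    unfolding forces_zero_sum_subseq_def s_def[symmetric] by blast
  have injI: "inj_on h I" using inj I(1) by (rule inj_on_subset)
  have sub: "h ` I \<subseteq> complete_hypergraph r d" using hK I(1) by auto
  have "finprod G c (h ` I) = \<one>"
    using finprod_reindex[of c h I] injI sub cc I(3) by auto
  moreover have "h ` I \<in> hyperstars r m"
  proof -
    have "0 \<in> \<Inter> (h ` I)" by (simp add: h_def)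
    moreover have "finite I" using I(1) finite_subset by blast
    moreover have "card (h ` I) = m" using card_image[OF injI] I(2) by simp
    ultimately show ?thesis using sub by (auto simp: hyperstars_def complete_hypergraph_def)
  qed
  moreover have "is_copy_of (h ` I) (h ` I)"
    unfolding is_copy_of_def by (rule exI[of _ id]) auto
  ultimately show "\<exists>E\<subseteq>complete_hypergraph r (Omega r (zero_sum_const m G)).
      (\<exists>F\<in>hyperstars r m. is_copy_of E F) \<and> finprod G c E = \<one>"
    using sub unfolding d_def by blast
qed

lemma zero_sum_ramsey_works:
  fixes G (structure)
  assumes "comm_group G" "finite (carrier G)" "m = k * group_exponent G" "r \<ge> 2"
    and "\<F> = intersecting_families r m \<or> \<F> = hyperstars r m"
  shows "zero_sum_ramsey r \<F> G > 0 \<and> forces_zero_sum_copy r \<F> G (zero_sum_ramsey r \<F> G)"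
proof -
  have "hyperstars r m \<subseteq> intersecting_families r m"
    by (auto simp: hyperstars_def intersecting_families_def)
  then have sub: "hyperstars r m \<subseteq> \<F>" using assms(5) by auto
  have "forces_zero_sum_copy r \<F> G (Omega r (zero_sum_const m G))"
    unfolding forces_zero_sum_copy_def
  proof
    fix c assume "c \<in> complete_hypergraph r (Omega r (zero_sum_const m G)) \<rightarrow> carrier G"
    then obtain E F where "E \<subseteq> complete_hypergraph r (Omega r (zero_sum_const m G))"
      "F \<in> hyperstars r m" "is_copy_of E F" "finprod G c E = \<one>"
      using forces_zero_sum_hyperstar[OF assms(1-4)] unfolding forces_zero_sum_copy_def by meson
    then show "\<exists>E\<subseteq>complete_hypergraph r (Omega r (zero_sum_const m G)).
        (\<exists>F\<in>\<F>. is_copy_of E F) \<and> finprod G c E = \<one>"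
      using sub by auto
  qed
  with Omega_works[OF assms(4)]
  have "Omega r (zero_sum_const m G) > 0 \<and>
      forces_zero_sum_copy r \<F> G (Omega r (zero_sum_const m G))" by blast
  then show ?thesis unfolding zero_sum_ramsey_def by (rule LeastI)
qed

end

theory Submission
  imports Defs
begin

text \<open>
  If the edges of \<open>K\<^sub>N\<close> split into \<open>M\<close> matchings, every sequence of length \<open>M\<close> in \<open>G\<close> becomes a
  coloring that is constant on each of them. An intersecting family uses each matching at most
  once, so a zero-sum intersecting family with \<open>m\<close> edges yields a zero-sum subsequence of length
  \<open>m\<close>, and \<open>M\<close> is at least the zero-sum constant. By Baranyai's theorem \<open>M\<close> matchings suffice as
  soon as \<open>M\<close> times \<open>N div r\<close> is at least the number of edges; this holds for \<open>M = N choose (r - 1)\<close>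
  always, and for \<open>M = (N - 1) choose (r - 1)\<close> if \<open>r\<close> divides \<open>N\<close>.

  Baranyai's theorem is proved as by Brouwer and Schrijver: vertices are added one at a time to
  partial matchings, and Hall's theorem rounds a fractional choice of the edges that receive the
  next vertex to an integral one.
\<close>

section \<open>Hall's theorem\<close>

definition hall_condition :: "'i set \<Rightarrow> ('i \<Rightarrow> 'a set) \<Rightarrow> bool" where
  "hall_condition J A \<longleftrightarrow> (\<forall>K\<subseteq>J. card K \<le> card (\<Union>j\<in>K. A j))"

lemma hall_conditionD: "hall_condition J A \<Longrightarrow> K \<subseteq> J \<Longrightarrow> card K \<le> card (\<Union>j\<in>K. A j)"
  by (simp add: hall_condition_def)

lemma hall_condition_remove_violator:
  assumes J: "finite J" and hall: "hall_condition J A"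
    and violated: "\<not> hall_condition J (A(i := A i - {z}))"
  obtains K where "K \<subseteq> J - {i}" "card (\<Union>(A ` K) \<union> (A i - {z})) \<le> card K"
proof -
  obtain L where L: "L \<subseteq> J" "card (\<Union>j\<in>L. (A(i := A i - {z})) j) < card L"
    using violated by (auto simp: hall_condition_def not_le)
  have "i \<in> L"
  proof (rule ccontr)
    assume "i \<notin> L"
    then have "(\<Union>j\<in>L. (A(i := A i - {z})) j) = (\<Union>j\<in>L. A j)" by auto
    then show False using L hall_conditionD[OF hall L(1)] by simp
  qed
  then have "(\<Union>j\<in>L. (A(i := A i - {z})) j) = \<Union>(A ` (L - {i})) \<union> (A i - {z})" by auto
  moreover have "card L = Suc (card (L - {i}))"
    using \<open>i \<in> L\<close> L(1) J by (metis card_Suc_Diff1 finite_subset)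
  ultimately have "card (\<Union>(A ` (L - {i})) \<union> (A i - {z})) \<le> card (L - {i})" using L(2) by simp
  moreover have "L - {i} \<subseteq> J - {i}" using L(1) by blast
  ultimately show thesis using that by blast
qed

text \<open>Rado's argument: if neither removal preserves the condition, submodularity of cardinality
  applied to the two violating index sets contradicts the condition for \<open>A\<close> itself.\<close>

lemma hall_condition_remove_element:
  assumes fin: "finite J" "\<And>j. j \<in> J \<Longrightarrow> finite (A j)"
    and hall: "hall_condition J A" and i: "i \<in> J" and "x \<noteq> y"
  shows "hall_condition J (A(i := A i - {x})) \<or> hall_condition J (A(i := A i - {y}))"
proof (rule ccontr)
  assume violated: "\<not> ?thesis"
  obtain K where K: "K \<subseteq> J - {i}" "card (\<Union>(A ` K) \<union> (A i - {x})) \<le> card K"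
    using hall_condition_remove_violator[OF fin(1) hall] violated by blast
  obtain L where L: "L \<subseteq> J - {i}" "card (\<Union>(A ` L) \<union> (A i - {y})) \<le> card L"
    using hall_condition_remove_violator[OF fin(1) hall] violated by blast
  define U where "U = \<Union>(A ` K) \<union> (A i - {x})"
  define W where "W = \<Union>(A ` L) \<union> (A i - {y})"
  have finKL: "finite K" "finite L" using K(1) L(1) fin(1) finite_subset by blast+
  have finUW: "finite U" "finite W" using K(1) L(1) finKL i fin(2) by (auto simp: U_def W_def)
  have "U \<union> W = (\<Union>j\<in>insert i (K \<union> L). A j)" using \<open>x \<noteq> y\<close> by (auto simp: U_def W_def)
  moreover have "insert i (K \<union> L) \<subseteq> J" using K(1) L(1) i by blast
  ultimately have "card (insert i (K \<union> L)) \<le> card (U \<union> W)"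
    using hall_conditionD[OF hall] by metis
  moreover have "i \<notin> K \<union> L" using K(1) L(1) by auto
  ultimately have "Suc (card (K \<union> L)) \<le> card (U \<union> W)" using finKL by simp
  moreover have "K \<inter> L \<subseteq> J" using K(1) by blast
  then have "card (K \<inter> L) \<le> card (\<Union>j\<in>K \<inter> L. A j)" by (rule hall_conditionD[OF hall])
  then have "card (K \<inter> L) \<le> card (U \<inter> W)"
    using card_mono[of "U \<inter> W" "\<Union>j\<in>K \<inter> L. A j"] finUW by (force simp: U_def W_def)
  moreover have "card (U \<union> W) + card (U \<inter> W) \<le> card (K \<union> L) + card (K \<inter> L)"
    using K(2) L(2) card_Un_Int[OF finUW] card_Un_Int[OF finKL] by (simp add: U_def W_def)
  ultimately show False by linarith
qed

theorem hall_marriage: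
  assumes "finite J" and "\<And>j. j \<in> J \<Longrightarrow> finite (A j)" and "hall_condition J A"
  shows "\<exists>h. inj_on h J \<and> (\<forall>j\<in>J. h j \<in> A j)"
  using assms(2,3)
proof (induction "\<Sum>j\<in>J. card (A j)" arbitrary: A rule: less_induct)
  case less
  note finA = less.prems(1) and hall = less.prems(2)
  show ?case
  proof (cases "\<exists>i\<in>J. \<exists>x\<in>A i. \<exists>y\<in>A i. x \<noteq> y")
    case True
    then obtain i z where i: "i \<in> J" and z: "z \<in> A i"
      and hall': "hall_condition J (A(i := A i - {z}))"
      using hall_condition_remove_element[OF assms(1) finA hall] by metis
    let ?A' = "A(i := A i - {z})"
    have "card (A i - {z}) < card (A i)" using finA[OF i] z by (rule card_Diff1_less)
    then have "(\<Sum>j\<in>J. card (?A' j)) < (\<Sum>j\<in>J. card (A j))"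
      by (intro sum_strict_mono_ex1[OF assms(1)]) (use i in auto)
    then obtain h where "inj_on h J" "\<forall>j\<in>J. h j \<in> ?A' j"
      using less.hyps[of ?A'] finA hall' by (metis finite_Diff fun_upd_apply)
    moreover have "?A' j \<subseteq> A j" for j by auto
    ultimately show ?thesis by blast
  next
    case False
    have "card {j} \<le> card (\<Union>k\<in>{j}. A k)" if "j \<in> J" for j
      by (rule hall_conditionD[OF hall]) (use that in simp)
    then have "A j \<noteq> {}" if "j \<in> J" for j using that by fastforce
    then have "\<exists>x. A j = {x}" if "j \<in> J" for j using False that by blast
    then obtain h where h: "A j = {h j}" if "j \<in> J" for j by metis
    have "inj_on h J"
    proof (rule inj_onI, rule ccontr)
      fix i j assume ij: "i \<in> J" "j \<in> J" "h i = h j" "i \<noteq> j"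
      have "card {i, j} \<le> card (\<Union>k\<in>{i, j}. A k)"
        by (rule hall_conditionD[OF hall]) (use ij in simp)
      then show False using ij h by simp
    qed
    then show ?thesis using h by auto
  qed
qed

lemma hall_marriage_capacities:
  fixes cap :: "'a \<Rightarrow> nat"
  assumes J: "finite J" and A: "\<And>j. j \<in> J \<Longrightarrow> finite (A j)"
    and hall: "\<And>K. K \<subseteq> J \<Longrightarrow> card K \<le> (\<Sum>x\<in>(\<Union>j\<in>K. A j). cap x)"
  obtains g where "\<And>j. j \<in> J \<Longrightarrow> g j \<in> A j" and "\<And>x. card {j\<in>J. g j = x} \<le> cap x"
proof -
  define B where "B j = Sigma (A j) (\<lambda>x. {..<cap x})" for j
  have "hall_condition J B"
    unfolding hall_condition_def
  proof (intro allI impI)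
    fix K assume K: "K \<subseteq> J"
    then have "finite (\<Union>j\<in>K. A j)" using J A by (meson finite_UN_I finite_subset subsetD)
    moreover have "(\<Union>j\<in>K. B j) = Sigma (\<Union>j\<in>K. A j) (\<lambda>x. {..<cap x})" by (auto simp: B_def)
    ultimately show "card K \<le> card (\<Union>j\<in>K. B j)" using hall[OF K] by simp
  qed
  then obtain h where h: "inj_on h J" "\<forall>j\<in>J. h j \<in> B j"
    using hall_marriage[of J B] J A by (auto simp: B_def)
  have "card {j\<in>J. fst (h j) = x} \<le> card {..<cap x}" for x
    by (rule card_inj_on_le[of "snd \<circ> h"])
      (use h in \<open>auto simp: B_def inj_on_def prod_eq_iff\<close>)
  then show thesis using h(2) by (intro that[of "fst \<circ> h"]) (auto simp: B_def)
qed

section \<open>Matchings in weighted bipartite graphs\<close>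

abbreviation fiber :: "('p \<Rightarrow> 'a) \<Rightarrow> 'p set \<Rightarrow> 'a \<Rightarrow> 'p set" where
  "fiber f P x \<equiv> {p \<in> P. f p = x}"

text \<open>Here \<open>P\<close> is the edge set of a bipartite graph: the edge \<open>p\<close> joins \<open>\<kappa> p\<close> to \<open>\<tau> p\<close> and has
  weight \<open>w p\<close>. The vertices \<open>x\<close> on the \<open>\<tau>\<close>-side may be met several times, in proportion to their
  weighted degree.\<close>

lemma card_le_sum_capacities:
  fixes w :: "'p \<Rightarrow> nat" and cap :: "'x \<Rightarrow> nat"
  assumes P: "finite P" and D: "D > 0" and K: "finite K"
    and left: "\<And>j. j \<in> K \<Longrightarrow> D \<le> sum w (fiber \<kappa> P j)"
    and right: "\<And>x. sum w (fiber \<tau> P x) \<le> D * cap x"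
  shows "card K \<le> (\<Sum>x\<in>\<tau> ` {p \<in> P. \<kappa> p \<in> K \<and> w p > 0}. cap x)"
proof -
  define N where "N = \<tau> ` {p \<in> P. \<kappa> p \<in> K \<and> w p > 0}"
  have "D * card K \<le> (\<Sum>j\<in>K. sum w (fiber \<kappa> P j))"
    using sum_mono[of K "\<lambda>_. D"] left by (simp add: mult.commute)
  also have "\<dots> = (\<Sum>j\<in>K. sum w (fiber \<kappa> {p \<in> P. \<kappa> p \<in> K} j))"
    by (intro sum.cong arg_cong[of _ _ "sum w"]) auto
  also have "\<dots> = sum w {p \<in> P. \<kappa> p \<in> K}"
    by (rule sum.group) (use P K in auto)
  also have "\<dots> = sum w {p \<in> P. \<kappa> p \<in> K \<and> w p > 0}"
    by (rule sum.mono_neutral_right) (use P in auto)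
  also have "\<dots> \<le> sum w {p \<in> P. \<tau> p \<in> N}"
    by (rule sum_mono2) (use P in \<open>auto simp: N_def\<close>)
  also have "\<dots> = (\<Sum>x\<in>N. sum w (fiber \<tau> {p \<in> P. \<tau> p \<in> N} x))"
    by (rule sum.group[symmetric]) (use P in \<open>auto simp: N_def\<close>)
  also have "\<dots> = (\<Sum>x\<in>N. sum w (fiber \<tau> P x))"
    by (intro sum.cong arg_cong[of _ _ "sum w"]) auto
  also have "\<dots> \<le> (\<Sum>x\<in>N. D * cap x)" by (rule sum_mono) (rule right)
  also have "\<dots> = D * (\<Sum>x\<in>N. cap x)" by (simp add: sum_distrib_left)
  finally show ?thesis using D by (simp add: N_def)
qed

lemma bipartite_selection_capacities:
  fixes w :: "'p \<Rightarrow> nat" and cap :: "'x \<Rightarrow> nat"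
  assumes P: "finite P" and D: "D > 0"
    and left: "\<And>j. j \<in> \<kappa> ` P \<Longrightarrow> D \<le> sum w (fiber \<kappa> P j)"
    and right: "\<And>x. sum w (fiber \<tau> P x) \<le> D * cap x"
  obtains X where "X \<subseteq> P" "inj_on \<kappa> X" "\<kappa> ` X = \<kappa> ` P" "\<And>p. p \<in> X \<Longrightarrow> w p > 0"
    "\<And>x. card (fiber \<tau> X x) \<le> cap x"
proof -
  define A where "A j = \<tau> ` {p \<in> P. \<kappa> p = j \<and> w p > 0}" for j
  obtain g where g: "\<And>j. j \<in> \<kappa> ` P \<Longrightarrow> g j \<in> A j"
    and g_le: "\<And>x. card {j\<in>\<kappa> ` P. g j = x} \<le> cap x"
  proof (rule hall_marriage_capacities[of "\<kappa> ` P" A cap])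
    show "finite (\<kappa> ` P)" "finite (A j)" for j using P by (simp_all add: A_def)
    show "card K \<le> (\<Sum>x\<in>(\<Union>j\<in>K. A j). cap x)" if K: "K \<subseteq> \<kappa> ` P" for K
    proof -
      have "(\<Union>j\<in>K. A j) = \<tau> ` {p \<in> P. \<kappa> p \<in> K \<and> w p > 0}" by (auto simp: A_def)
      moreover have "finite K" using P K finite_surj by blast
      ultimately show ?thesis
        using card_le_sum_capacities[OF P D _ left[OF subsetD[OF K]] right] by simp
    qed
  qed (rule that)
  have "\<exists>p\<in>P. \<kappa> p = j \<and> \<tau> p = g j \<and> w p > 0" if "j \<in> \<kappa> ` P" for j
    using g[OF that] by (fastforce simp: A_def)
  then obtain s where s: "s j \<in> P" "\<kappa> (s j) = j" "\<tau> (s j) = g j" "w (s j) > 0"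
    if "j \<in> \<kappa> ` P" for j by metis
  define X where "X = s ` \<kappa> ` P"
  have "X \<subseteq> P" "inj_on \<kappa> X" "\<kappa> ` X = \<kappa> ` P"
    using s(1,2) by (auto simp: X_def image_iff inj_on_def)
  moreover have "w p > 0" if "p \<in> X" for p using s(4) that by (auto simp: X_def)
  moreover have "card (fiber \<tau> X x) \<le> cap x" for x
  proof -
    have "fiber \<tau> X x = s ` {j\<in>\<kappa> ` P. \<tau> (s j) = x}" by (auto simp: X_def)
    also have "{j\<in>\<kappa> ` P. \<tau> (s j) = x} = {j\<in>\<kappa> ` P. g j = x}" by (simp add: s(3) cong: conj_cong)
    finally have "card (fiber \<tau> X x) \<le> card {j\<in>\<kappa> ` P. g j = x}"
      using P by (simp only:) (rule card_image_le, simp)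
    then show ?thesis using g_le by (rule le_trans)
  qed
  ultimately show thesis by (rule that)
qed

text \<open>With regular left side the selection has as many edges as the right capacities allow in
  total, so every capacity is attained.\<close>

lemma regular_bipartite_selection:
  fixes w :: "'p \<Rightarrow> nat"
  assumes P: "finite P" and D: "D > 0"
    and left: "\<And>j. j \<in> \<kappa> ` P \<Longrightarrow> sum w (fiber \<kappa> P j) = D"
    and right: "\<And>x. D dvd sum w (fiber \<tau> P x)"
  obtains X where "X \<subseteq> P" "inj_on \<kappa> X" "\<kappa> ` X = \<kappa> ` P" "\<And>p. p \<in> X \<Longrightarrow> w p > 0"
    "\<And>x. D * card (fiber \<tau> X x) = sum w (fiber \<tau> P x)"
proof -
  define cap where "cap x = sum w (fiber \<tau> P x) div D" for x
  have cap: "D * cap x = sum w (fiber \<tau> P x)" for x using right by (simp add: cap_def)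
  obtain X where X: "X \<subseteq> P" "inj_on \<kappa> X" "\<kappa> ` X = \<kappa> ` P" "\<And>p. p \<in> X \<Longrightarrow> w p > 0"
    and le: "\<And>x. card (fiber \<tau> X x) \<le> cap x"
  proof (rule bipartite_selection_capacities[OF P D])
    show "D \<le> sum w (fiber \<kappa> P j)" if "j \<in> \<kappa> ` P" for j using left[OF that] by simp
    show "sum w (fiber \<tau> P x) \<le> D * cap x" for x by (simp add: cap)
  qed (rule that)
  have "D * (\<Sum>x\<in>\<tau> ` P. card (fiber \<tau> X x)) = D * card X"
    using sum.group[of X "\<tau> ` P" \<tau> "\<lambda>_. 1::nat"] X(1) P finite_subset[OF X(1)]
    by (simp add: image_mono)
  also have "\<dots> = (\<Sum>j\<in>\<kappa> ` P. sum w (fiber \<kappa> P j))"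
    using left card_image[OF X(2)] X(3) by simp
  also have "\<dots> = (\<Sum>x\<in>\<tau> ` P. D * cap x)"
    unfolding cap using P by (simp add: sum.group)
  also have "\<dots> = D * (\<Sum>x\<in>\<tau> ` P. cap x)" by (simp add: sum_distrib_left)
  finally have total: "(\<Sum>x\<in>\<tau> ` P. card (fiber \<tau> X x)) = (\<Sum>x\<in>\<tau> ` P. cap x)" using D by simp
  have "card (fiber \<tau> X x) = cap x" for x
  proof (cases "x \<in> \<tau> ` P")
    case True
    then show ?thesis using sum_mono_inv[OF total le] P by simp
  next
    case False
    then have empty: "fiber \<tau> X x = {}" "fiber \<tau> P x = {}" using X(1) by auto
    show ?thesis unfolding cap_def empty by simp
  qed
  then show thesis using cap by (intro that[OF X]) simp_all
qed

definition deficiency :: "('p \<Rightarrow> 'j) \<Rightarrow> 'p set \<Rightarrow> ('p \<Rightarrow> nat) \<Rightarrow> nat \<Rightarrow> 'j \<Rightarrow> nat" where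
  "deficiency \<kappa> P w D j = D - sum w (fiber \<kappa> P j)"

lemma dvd_sum_deficiency:
  assumes P: "finite P" and left: "\<And>j. sum w (fiber \<kappa> P j) \<le> D"
    and right: "\<And>x. D dvd sum w (fiber \<tau> P x)"
  shows "D dvd sum (deficiency \<kappa> P w D) (\<kappa> ` P)"
proof -
  have "sum w P = (\<Sum>x\<in>\<tau> ` P. sum w (fiber \<tau> P x))" using P by (simp add: sum.group)
  then have "D dvd sum w P" using right by (simp add: dvd_sum)
  moreover have "sum (deficiency \<kappa> P w D) (\<kappa> ` P) + sum w P
      = (\<Sum>j\<in>\<kappa> ` P. deficiency \<kappa> P w D j + sum w (fiber \<kappa> P j))"
    unfolding sum.distrib using P by (simp add: sum.group)
  then have "D dvd sum (deficiency \<kappa> P w D) (\<kappa> ` P) + sum w P"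
    using left by (simp add: deficiency_def)
  ultimately show ?thesis by (simp add: dvd_add_left_iff)
qed

lemma sum_fiber_padded_left:
  assumes "finite P" and "sum w (fiber \<kappa> P j) \<le> D" and "j \<in> \<kappa> ` P"
  shows "sum (case_sum w (deficiency \<kappa> P w D)) (fiber (case_sum \<kappa> (\<lambda>i. i)) (P <+> \<kappa> ` P) j) = D"
proof -
  have "fiber (case_sum \<kappa> (\<lambda>i. i)) (P <+> \<kappa> ` P) j = fiber \<kappa> P j <+> {j}"
    using assms(3) by auto
  then show ?thesis using assms(1,2) by (simp add: sum.Plus comp_def deficiency_def)
qed

lemma fiber_case_sum_Some:
  "fiber (case_sum (Some \<circ> \<tau>) (\<lambda>_. None)) Y (Some x) = Inl ` fiber \<tau> {p. Inl p \<in> Y} x"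
  by (auto split: sum.split_asm)

lemma sum_fiber_padded_Some:
  "sum (case_sum w v) (fiber (case_sum (Some \<circ> \<tau>) (\<lambda>_. None)) (P <+> J) (Some x))
    = sum w (fiber \<tau> P x)"
proof -
  have "{p. Inl p \<in> P <+> J} = P" by auto
  then show ?thesis unfolding fiber_case_sum_Some by (simp add: sum.reindex)
qed

lemma sum_fiber_padded_None:
  "sum (case_sum w v) (fiber (case_sum (Some \<circ> \<tau>) (\<lambda>_. None)) (P <+> J) None) = sum v J"
proof -
  have "fiber (case_sum (Some \<circ> \<tau>) (\<lambda>_. None)) (P <+> J) None = Inr ` J" by auto
  then show ?thesis by (simp add: sum.reindex)
qed

text \<open>The case of unequal left degrees is reduced to the regular one by joining every left vertex
  to one additional right vertex \<open>None\<close>, the edge having the missing weight.\<close>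

lemma bipartite_selection:
  fixes w :: "'p \<Rightarrow> nat" and \<kappa> :: "'p \<Rightarrow> 'j"
  assumes P: "finite P" and D: "D > 0"
    and left: "\<And>j. sum w (fiber \<kappa> P j) \<le> D"
    and right: "\<And>x. D dvd sum w (fiber \<tau> P x)"
  obtains X where "X \<subseteq> P" "inj_on \<kappa> X" "\<And>p. p \<in> X \<Longrightarrow> w p > 0"
    "\<And>j. sum w (fiber \<kappa> P j) = D \<Longrightarrow> j \<in> \<kappa> ` X"
    "\<And>x. D * card (fiber \<tau> X x) = sum w (fiber \<tau> P x)"
proof -
  define Q where "Q = P <+> \<kappa> ` P"
  define \<kappa>' where "\<kappa>' = case_sum \<kappa> (\<lambda>j. j)"
  define \<tau>' where "\<tau>' = case_sum (Some \<circ> \<tau>) (\<lambda>_::'j. None)"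
  define w' where "w' = case_sum w (deficiency \<kappa> P w D)"
  note defs = Q_def \<kappa>'_def \<tau>'_def w'_def
  have right_Some: "sum w' (fiber \<tau>' Q (Some x)) = sum w (fiber \<tau> P x)" for x
    unfolding defs by (rule sum_fiber_padded_Some)
  have right_None: "sum w' (fiber \<tau>' Q None) = sum (deficiency \<kappa> P w D) (\<kappa> ` P)"
    unfolding defs by (rule sum_fiber_padded_None)
  have image: "\<kappa>' ` Q = \<kappa> ` P" by (simp add: defs Plus_def image_Un image_image)
  obtain Y where Y: "Y \<subseteq> Q" "inj_on \<kappa>' Y" "\<kappa>' ` Y = \<kappa>' ` Q" "\<And>p. p \<in> Y \<Longrightarrow> w' p > 0"
    and balanced: "\<And>x. D * card (fiber \<tau>' Y x) = sum w' (fiber \<tau>' Q x)"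
  proof (rule regular_bipartite_selection[OF _ D])
    show "finite Q" using P by (simp add: Q_def)
    show "sum w' (fiber \<kappa>' Q j) = D" if "j \<in> \<kappa>' ` Q" for j
      using sum_fiber_padded_left[OF P left] that unfolding image by (simp add: defs)
    show "D dvd sum w' (fiber \<tau>' Q x)" for x
      using right dvd_sum_deficiency[OF P left right]
      by (cases x) (simp_all add: right_Some right_None)
  qed (rule that)
  define X where "X = {p. Inl p \<in> Y}"
  have "j \<in> \<kappa> ` X" if saturated: "sum w (fiber \<kappa> P j) = D" for j
  proof -
    have "fiber \<kappa> P j \<noteq> {}" using saturated D by (metis less_irrefl sum.empty)
    then have "j \<in> \<kappa>' ` Y" unfolding Y(3) image by blast
    moreover have "Inr j \<notin> Y" using Y(4)[of "Inr j"] saturated by (auto simp: w'_def deficiency_def)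
    ultimately show ?thesis by (auto simp: X_def \<kappa>'_def split: sum.split_asm)
  qed
  moreover have "X \<subseteq> P" using Y(1) by (auto simp: X_def Q_def)
  moreover have "inj_on \<kappa> X" using Y(2) by (force simp: X_def \<kappa>'_def inj_on_def)
  moreover have "w p > 0" if "p \<in> X" for p using Y(4)[of "Inl p"] that by (simp add: X_def w'_def)
  moreover have "D * card (fiber \<tau> X x) = sum w (fiber \<tau> P x)" for x
    using balanced[of "Some x"] unfolding right_Some
    by (simp add: \<tau>'_def fiber_case_sum_Some X_def card_image)
  ultimately show thesis using that by blast
qed

section \<open>Baranyai's theorem for matchings\<close>

text \<open>The edges to be constructed are indexed by \<open>P\<close>, and \<open>\<kappa> p\<close> is the matching that edge \<open>p\<close> will
  belong to; \<open>t p\<close> is its trace on the set \<open>A\<close> of vertices treated so far, and \<open>d\<close> vertices remain.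
  The third clause says that these suffice to complete all edges of a matching, the fourth one
  that \<open>S\<close> is a trace as often as it has extensions to an \<open>r\<close>-set.\<close>

definition partial_matchings ::
    "'p set \<Rightarrow> ('p \<Rightarrow> 'j) \<Rightarrow> nat \<Rightarrow> 'v set \<Rightarrow> nat \<Rightarrow> ('p \<Rightarrow> 'v set) \<Rightarrow> bool" where
  "partial_matchings P \<kappa> r A d t \<longleftrightarrow>
    (\<forall>p\<in>P. t p \<subseteq> A \<and> card (t p) \<le> r) \<and>
    pairwise (\<lambda>p q. \<kappa> p = \<kappa> q \<longrightarrow> disjnt (t p) (t q)) P \<and>
    (\<forall>j. (\<Sum>p\<in>fiber \<kappa> P j. r - card (t p)) \<le> d) \<and>
    (\<forall>S\<subseteq>A. card S \<le> r \<longrightarrow> card (fiber t P S) = d choose (r - card S))"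

text \<open>Giving the next vertex to each edge with trace \<open>S\<close> with probability
  \<open>(r - card S) / Suc d\<close> is a fractional solution.\<close>

lemma partial_matchings_selection:
  assumes P: "finite P" and t: "partial_matchings P \<kappa> r A (Suc d) t"
  obtains X where "X \<subseteq> P" "inj_on \<kappa> X" "\<And>p. p \<in> X \<Longrightarrow> card (t p) < r"
    "\<And>j. (\<Sum>p\<in>fiber \<kappa> P j. r - card (t p)) = Suc d \<Longrightarrow> j \<in> \<kappa> ` X"
    "\<And>S. S \<subseteq> A \<Longrightarrow> card S < r \<Longrightarrow> card (fiber t X S) = d choose (r - Suc (card S))"
proof -
  define w where "w p = r - card (t p)" for p
  have weight: "sum w (fiber t P S) = card (fiber t P S) * (r - card S)" for S
    by (simp add: w_def)
  have right: "sum w (fiber t P S) = Suc d * (d choose (r - Suc (card S)))"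
    if "S \<subseteq> A" "card S < r" for S
  proof -
    have "sum w (fiber t P S) = (Suc d choose (r - card S)) * (r - card S)"
      using t that unfolding weight partial_matchings_def by simp
    then show ?thesis
      using times_binomial_minus1_eq[of "r - card S" "Suc d"] that(2) by (simp add: mult.commute)
  qed
  obtain X where X: "X \<subseteq> P" "inj_on \<kappa> X" "\<And>p. p \<in> X \<Longrightarrow> w p > 0"
      "\<And>j. sum w (fiber \<kappa> P j) = Suc d \<Longrightarrow> j \<in> \<kappa> ` X"
    and balanced: "\<And>S. Suc d * card (fiber t X S) = sum w (fiber t P S)"
  proof (rule bipartite_selection[OF P zero_less_Suc])
    show "sum w (fiber \<kappa> P j) \<le> Suc d" for j using t by (simp add: partial_matchings_def w_def)
    show "Suc d dvd sum w (fiber t P S)" for S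
    proof (cases "S \<subseteq> A \<and> card S < r")
      case True
      then show ?thesis using right[of S] by (metis dvd_triv_left)
    next
      case False
      then have "fiber t P S = {} \<or> r - card S = 0" using t by (auto simp: partial_matchings_def)
      then show ?thesis unfolding weight by (metis card.empty dvd_0_right mult_0 mult_0_right)
    qed
  qed (rule that)
  have "card (fiber t X S) = d choose (r - Suc (card S))" if "S \<subseteq> A" "card S < r" for S
    using balanced[of S] unfolding right[OF that] by (simp only: mult_cancel1) simp
  then show thesis using X by (intro that[of X]) (simp_all add: w_def)
qed

definition insert_on :: "'p set \<Rightarrow> 'v \<Rightarrow> ('p \<Rightarrow> 'v set) \<Rightarrow> 'p \<Rightarrow> 'v set" where
  "insert_on X v t p = (if p \<in> X then insert v (t p) else t p)"

lemma fiber_insert_on_insert: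
  assumes "X \<subseteq> P" and "\<And>p. p \<in> P \<Longrightarrow> v \<notin> t p" and "v \<notin> S"
  shows "fiber (insert_on X v t) P (insert v S) = fiber t X S"
  using assms by (auto simp: insert_on_def insert_ident)

lemma fiber_insert_on_notin:
  assumes "v \<notin> S"
  shows "fiber (insert_on X v t) P S = fiber t P S - fiber t X S"
  using assms by (auto simp: insert_on_def)

lemma card_fiber_insert_on:
  assumes P: "finite P" and A: "finite A" "v \<notin> A" and t: "partial_matchings P \<kappa> r A (Suc d) t"
    and X: "X \<subseteq> P" "\<And>p. p \<in> X \<Longrightarrow> card (t p) < r"
    and count: "\<And>S. S \<subseteq> A \<Longrightarrow> card S < r \<Longrightarrow> card (fiber t X S) = d choose (r - Suc (card S))"
    and T: "T \<subseteq> insert v A" "card T \<le> r"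
  shows "card (fiber (insert_on X v t) P T) = d choose (r - card T)"
proof (cases "v \<in> T")
  case True
  define S where "S = T - {v}"
  have S: "T = insert v S" "v \<notin> S" "S \<subseteq> A" using True T(1) by (auto simp: S_def)
  then have "card T = Suc (card S)" using A(1) finite_subset by (metis card_insert_disjoint)
  moreover have "v \<notin> t p" if "p \<in> P" for p using t A(2) that by (auto simp: partial_matchings_def)
  ultimately show ?thesis
    using fiber_insert_on_insert[OF X(1), of v t S] count[OF S(3)] S(1,2) T(2) by simp
next
  case False
  then have T_sub: "T \<subseteq> A" using T(1) by blast
  have card_eq: "card (fiber (insert_on X v t) P T)
      = (Suc d choose (r - card T)) - card (fiber t X T)"
  proof -
    have sub: "fiber t X T \<subseteq> fiber t P T" using X(1) by blast
    have "finite (fiber t X T)" by (rule finite_subset[OF sub]) (use P in simp)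
    then have "card (fiber t P T - fiber t X T) = card (fiber t P T) - card (fiber t X T)"
      using sub by (rule card_Diff_subset)
    then show ?thesis
      using t T_sub T(2) by (simp add: fiber_insert_on_notin[OF False] partial_matchings_def)
  qed
  show ?thesis
  proof (cases "card T < r")
    case True
    then have "r - card T = Suc (r - Suc (card T))" by simp
    then show ?thesis using card_eq count[OF T_sub True] by simp
  next
    case no_room: False
    then have none: "fiber t X T = {}" using X(2) by auto
    show ?thesis using no_room T(2) unfolding card_eq none by simp
  qed
qed

lemma sum_remaining_insert_on_le:
  assumes P: "finite P" and X: "X \<subseteq> P" "\<And>p. p \<in> X \<Longrightarrow> card (t p) < r"
    and t: "\<And>p. p \<in> P \<Longrightarrow> finite (t p)" "\<And>p. p \<in> P \<Longrightarrow> v \<notin> t p"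
    and le: "(\<Sum>p\<in>fiber \<kappa> P j. r - card (t p)) \<le> Suc d"
    and saturated: "(\<Sum>p\<in>fiber \<kappa> P j. r - card (t p)) = Suc d \<Longrightarrow> j \<in> \<kappa> ` X"
  shows "(\<Sum>p\<in>fiber \<kappa> P j. r - card (insert_on X v t p)) \<le> d"
proof (cases "j \<in> \<kappa> ` X")
  case True
  then obtain q where q: "q \<in> X" "\<kappa> q = j" by blast
  have "(\<Sum>p\<in>fiber \<kappa> P j. r - card (insert_on X v t p)) < (\<Sum>p\<in>fiber \<kappa> P j. r - card (t p))"
  proof (rule sum_strict_mono_ex1)
    show "\<forall>p\<in>fiber \<kappa> P j. r - card (insert_on X v t p) \<le> r - card (t p)"
      using t by (simp add: insert_on_def diff_le_mono2)
    have "r - card (insert_on X v t q) < r - card (t q)"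
      using q X t by (simp add: insert_on_def subset_eq diff_less_mono2)
    then show "\<exists>p\<in>fiber \<kappa> P j. r - card (insert_on X v t p) < r - card (t p)" using q X(1) by blast
  qed (use P in simp)
  then show ?thesis using le by linarith
next
  case False
  then have "(\<Sum>p\<in>fiber \<kappa> P j. r - card (insert_on X v t p)) = (\<Sum>p\<in>fiber \<kappa> P j. r - card (t p))"
    by (intro sum.cong) (auto simp: insert_on_def)
  then show ?thesis using le saturated False by linarith
qed

lemma pairwise_disjnt_insert_on:
  assumes "pairwise (\<lambda>p q. \<kappa> p = \<kappa> q \<longrightarrow> disjnt (t p) (t q)) P" and "inj_on \<kappa> X"
    and "\<And>p. p \<in> P \<Longrightarrow> v \<notin> t p"
  shows "pairwise (\<lambda>p q. \<kappa> p = \<kappa> q \<longrightarrow> disjnt (insert_on X v t p) (insert_on X v t q)) P"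
  using assms by (auto simp: pairwise_def insert_on_def disjnt_def inj_on_def)

lemma partial_matchings_extend:
  assumes P: "finite P" and A: "finite A" "v \<notin> A" and t: "partial_matchings P \<kappa> r A (Suc d) t"
  shows "\<exists>t'. partial_matchings P \<kappa> r (insert v A) d t'"
proof -
  obtain X where X: "X \<subseteq> P" "inj_on \<kappa> X" "\<And>p. p \<in> X \<Longrightarrow> card (t p) < r"
    and saturated: "\<And>j. (\<Sum>p\<in>fiber \<kappa> P j. r - card (t p)) = Suc d \<Longrightarrow> j \<in> \<kappa> ` X"
    and count: "\<And>S. S \<subseteq> A \<Longrightarrow> card S < r \<Longrightarrow> card (fiber t X S) = d choose (r - Suc (card S))"
    by (rule partial_matchings_selection[OF P t]) (rule that)
  have traces: "t p \<subseteq> A" "card (t p) \<le> r" "finite (t p)" "v \<notin> t p" if "p \<in> P" for p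
    using t that A finite_subset by (auto simp: partial_matchings_def)
  have "insert_on X v t p \<subseteq> insert v A \<and> card (insert_on X v t p) \<le> r" if "p \<in> P" for p
    using traces[OF that] X(3)[of p] by (auto simp: insert_on_def)
  moreover have "pairwise (\<lambda>p q. \<kappa> p = \<kappa> q \<longrightarrow> disjnt (insert_on X v t p) (insert_on X v t q)) P"
    by (rule pairwise_disjnt_insert_on)
      (use X(2) traces(4) t in \<open>simp_all add: partial_matchings_def\<close>)
  moreover have "(\<Sum>p\<in>fiber \<kappa> P j. r - card (insert_on X v t p)) \<le> d" for j
    using sum_remaining_insert_on_le[OF P X(1,3) traces(3,4) _ saturated] t
    by (simp add: partial_matchings_def)
  moreover have "card (fiber (insert_on X v t) P T) = d choose (r - card T)"
    if "T \<subseteq> insert v A" "card T \<le> r" for T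
    using card_fiber_insert_on[OF P A t X(1,3) count that] .
  ultimately have "partial_matchings P \<kappa> r (insert v A) d (insert_on X v t)"
    unfolding partial_matchings_def by blast
  then show ?thesis by blast
qed

lemma partial_matchings_exist:
  assumes P: "finite P" and V: "finite V" and card_P: "card P = (card V + d) choose r"
    and \<kappa>: "\<And>j. card (fiber \<kappa> P j) * r \<le> card V + d"
  shows "\<exists>t. partial_matchings P \<kappa> r V d t"
  using V card_P \<kappa>
proof (induction V arbitrary: d rule: finite_induct)
  case empty
  then have "partial_matchings P \<kappa> r {} d (\<lambda>_. {})"
    by (auto simp: partial_matchings_def pairwise_def)
  then show ?case by blast
next
  case (insert v V)
  then have "\<exists>t. partial_matchings P \<kappa> r V (Suc d) t" by simp
  then show ?case using partial_matchings_extend[OF P insert.hyps] by blast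
qed

theorem baranyai_matchings:
  assumes P: "finite P" and V: "finite V" and card_P: "card P = card V choose r"
    and \<kappa>: "\<And>j. card (fiber \<kappa> P j) * r \<le> card V"
  shows "\<exists>t. bij_betw t P {e. e \<subseteq> V \<and> card e = r} \<and>
    pairwise (\<lambda>p q. \<kappa> p = \<kappa> q \<longrightarrow> disjnt (t p) (t q)) P"
proof -
  obtain t where t: "partial_matchings P \<kappa> r V 0 t"
    using partial_matchings_exist[OF P V, of 0 r \<kappa>] card_P \<kappa> by auto
  have t_mem: "t p \<subseteq> V \<and> card (t p) = r" if "p \<in> P" for p
  proof -
    have "(\<Sum>q\<in>fiber \<kappa> P (\<kappa> p). r - card (t q)) = 0" using t by (simp add: partial_matchings_def)
    then have "r - card (t p) = 0" using P that by simp
    moreover have "t p \<subseteq> V" "card (t p) \<le> r" using t that by (simp_all add: partial_matchings_def)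
    ultimately show ?thesis by simp
  qed
  have single: "\<exists>p. fiber t P e = {p}" if "e \<subseteq> V" "card e = r" for e
  proof -
    have "card (fiber t P e) = 1" using t that by (simp add: partial_matchings_def)
    then show ?thesis by (rule card_1_singletonE) blast
  qed
  have "inj_on t P"
  proof (rule inj_onI)
    fix p q assume pq: "p \<in> P" "q \<in> P" "t p = t q"
    obtain x where x: "fiber t P (t p) = {x}" using single t_mem[OF pq(1)] by blast
    have "p \<in> fiber t P (t p)" "q \<in> fiber t P (t p)" using pq by auto
    then show "p = q" unfolding x by simp
  qed
  moreover have "t ` P = {e. e \<subseteq> V \<and> card e = r}"
  proof (intro equalityI subsetI)
    fix e assume "e \<in> {e. e \<subseteq> V \<and> card e = r}"
    then obtain p where "fiber t P e = {p}" using single by blast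
    then show "e \<in> t ` P" by blast
  qed (use t_mem in auto)
  ultimately show ?thesis using t by (auto simp: bij_betw_def partial_matchings_def)
qed

section \<open>Zero-sum Ramsey numbers\<close>

definition proper_edge_coloring :: "'v set set \<Rightarrow> ('v set \<Rightarrow> 'c) \<Rightarrow> bool" where
  "proper_edge_coloring E \<chi> \<longleftrightarrow> pairwise (\<lambda>e f. \<chi> e = \<chi> f \<longrightarrow> disjnt e f) E"

lemma complete_hypergraph_proper_edge_coloring:
  assumes capacity: "N choose r \<le> M * (N div r)"
  obtains \<chi> where "\<chi> \<in> complete_hypergraph r N \<rightarrow> {..<M}"
    and "proper_edge_coloring (complete_hypergraph r N) \<chi>"
proof -
  have "N choose r \<le> card ({..<M} \<times> {..<N div r})" using capacity by simp
  then obtain P where P: "P \<subseteq> {..<M} \<times> {..<N div r}" "card P = N choose r" "finite P"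
    by (rule obtain_subset_with_card_n)
  have class_size: "card (fiber fst P j) * r \<le> N" for j
  proof -
    have "fiber fst P j \<subseteq> {j} \<times> {..<N div r}" using P(1) by auto
    then have "card (fiber fst P j) \<le> card ({j} \<times> {..<N div r})" by (intro card_mono) simp_all
    then have "card (fiber fst P j) * r \<le> N div r * r" by simp
    then show ?thesis using div_times_less_eq_dividend le_trans by blast
  qed
  then obtain t where t: "bij_betw t P (complete_hypergraph r N)"
    and matchings: "pairwise (\<lambda>p q. fst p = fst q \<longrightarrow> disjnt (t p) (t q)) P"
    using baranyai_matchings[OF P(3), of "{..<N}" r fst] P(2)
    by (auto simp: complete_hypergraph_def)
  define s where "s = inv_into P t"
  have s: "s e \<in> P" "t (s e) = e" if "e \<in> complete_hypergraph r N" for e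
    using t that by (simp_all add: s_def bij_betw_def inv_into_into f_inv_into_f)
  show thesis
  proof
    show "fst \<circ> s \<in> complete_hypergraph r N \<rightarrow> {..<M}" using s(1) P(1) by fastforce
    show "proper_edge_coloring (complete_hypergraph r N) (fst \<circ> s)"
      unfolding proper_edge_coloring_def
    proof (intro pairwiseI impI)
      fix e f assume ef: "e \<in> complete_hypergraph r N" "f \<in> complete_hypergraph r N" "e \<noteq> f"
        and same_color: "(fst \<circ> s) e = (fst \<circ> s) f"
      have "s e \<noteq> s f" using s(2) ef by metis
      then have "disjnt (t (s e)) (t (s f))"
        using pairwiseD[OF matchings s(1)[OF ef(1)] s(1)[OF ef(2)]] same_color by simp
      then show "disjnt e f" by (simp add: s(2) ef)
    qed
  qed
qed

lemma is_copy_of_intersecting_family: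
  assumes F: "F \<in> intersecting_families r m" and "is_copy_of E F"
  shows "E \<in> intersecting_families r m"
proof -
  obtain \<phi> where \<phi>: "inj_on \<phi> (\<Union>F)" and E: "E = (\<lambda>e. \<phi> ` e) ` F"
    using assms(2) by (auto simp: is_copy_of_def)
  have "card E = m"
    using F inj_on_image[OF \<phi>] by (simp add: E card_image intersecting_families_def)
  moreover have "card (\<phi> ` e) = r" if "e \<in> F" for e
    using F that inj_on_subset[OF \<phi> Union_upper[OF that]]
    by (simp add: card_image intersecting_families_def)
  moreover have "\<phi> ` e \<inter> \<phi> ` f \<noteq> {}" if "e \<in> F" "f \<in> F" for e f
    using F that by (fastforce simp: intersecting_families_def)
  ultimately show ?thesis using F by (auto simp: E intersecting_families_def)
qed

lemma inj_on_proper_edge_coloring: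
  assumes "proper_edge_coloring H \<chi>" and "E \<subseteq> H" and "E \<in> intersecting_families r m"
  shows "inj_on \<chi> E"
proof (rule inj_onI, rule ccontr)
  fix e f assume "e \<in> E" "f \<in> E" "\<chi> e = \<chi> f" "e \<noteq> f"
  then have "disjnt e f"
    using assms(1,2) by (auto simp: proper_edge_coloring_def pairwise_def)
  moreover have "e \<inter> f \<noteq> {}"
    using assms(3) \<open>e \<in> E\<close> \<open>f \<in> E\<close> by (simp add: intersecting_families_def)
  ultimately show False by (simp add: disjnt_def)
qed

lemma forces_zero_sum_subseq_of_intersecting:
  fixes G (structure)
  assumes "comm_group G" and forces: "forces_zero_sum_copy r (intersecting_families r m) G N"
    and \<chi>: "\<chi> \<in> complete_hypergraph r N \<rightarrow> {..<M}"
    and proper: "proper_edge_coloring (complete_hypergraph r N) \<chi>"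
  shows "forces_zero_sum_subseq G m M"
  unfolding forces_zero_sum_subseq_def
proof
  interpret comm_group G by fact
  fix a assume a: "a \<in> {..<M} \<rightarrow> carrier G"
  have "(\<lambda>e. a (\<chi> e)) \<in> complete_hypergraph r N \<rightarrow> carrier G" using a \<chi> by auto
  then obtain E F where E: "E \<subseteq> complete_hypergraph r N" and F: "F \<in> intersecting_families r m"
    "is_copy_of E F" and zero_sum: "finprod G (\<lambda>e. a (\<chi> e)) E = \<one>"
    using forces unfolding forces_zero_sum_copy_def by meson
  have E_int: "E \<in> intersecting_families r m" using is_copy_of_intersecting_family[OF F] .
  have inj: "inj_on \<chi> E" by (rule inj_on_proper_edge_coloring[OF proper E E_int])
  have sub: "\<chi> ` E \<subseteq> {..<M}" using \<chi> E by auto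
  moreover have "card (\<chi> ` E) = m"
    using E_int card_image[OF inj] by (simp add: intersecting_families_def)
  moreover have "finprod G a (\<chi> ` E) = \<one>"
    using finprod_reindex[of a \<chi> E] sub a inj zero_sum by auto
  ultimately show "\<exists>I\<subseteq>{..<M}. card I = m \<and> finprod G a I = \<one>" by blast
qed

lemma zero_sum_const_le:
  assumes "forces_zero_sum_subseq G m M" and "m > 0"
  shows "zero_sum_const m G \<le> M"
proof -
  have "M > 0"
  proof (rule ccontr)
    assume "\<not> M > 0"
    then obtain I :: "nat set" where "I \<subseteq> {}" "card I = m"
      using assms(1) by (auto simp: forces_zero_sum_subseq_def)
    then show False using assms(2) by simp
  qed
  then show ?thesis using assms(1) by (simp add: zero_sum_const_def Least_le)
qed

lemma zero_sum_const_le_matchings: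
  assumes "comm_group G" and "forces_zero_sum_copy r (intersecting_families r m) G N"
    and "N choose r \<le> M * (N div r)" and "m > 0"
  shows "zero_sum_const m G \<le> M"
proof -
  obtain \<chi> where "\<chi> \<in> complete_hypergraph r N \<rightarrow> {..<M}"
    and "proper_edge_coloring (complete_hypergraph r N) \<chi>"
    using complete_hypergraph_proper_edge_coloring[OF assms(3)] .
  then show ?thesis
    using forces_zero_sum_subseq_of_intersecting[OF assms(1,2)] zero_sum_const_le assms(4) by blast
qed

lemma binomial_le_matching_capacity:
  assumes "r > 0"
  shows "N choose r \<le> (N choose (r - 1)) * (N div r)"
proof (cases "N < r")
  case False
  have "r * (N choose r) = (N - (r - 1)) * (N choose (r - 1))"
    using times_binomial_minus1_eq[OF assms] binomial_absorb_comp[of N "r - 1"] by simp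
  also have "N - (r - 1) \<le> r * (N div r)"
    using mult_div_mod_eq[of r N] mod_less_divisor[OF assms, of N] by linarith
  finally show ?thesis using assms by (simp add: mult.assoc mult.left_commute mult.commute)
qed simp

lemma binomial_eq_matching_capacity:
  assumes "r > 0" and "r dvd N"
  shows "N choose r = ((N - 1) choose (r - 1)) * (N div r)"
proof -
  have "r * (N choose r) = r * (((N - 1) choose (r - 1)) * (N div r))"
    using times_binomial_minus1_eq[OF assms(1), of N] assms(2) by (auto simp: mult.left_commute)
  then show ?thesis using assms(1) by simp
qed

lemma Omega_le:
  assumes "n > 0" and "s \<le> (n - 1) choose (r - 1)"
  shows "Omega r s \<le> n"
  using assms by (simp add: Omega_def Least_le)

lemma Omega_le_Suc_of_intersecting:
  assumes "comm_group G" and "forces_zero_sum_copy r (intersecting_families r m) G N"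
    and "r > 0" and "m > 0"
  shows "Omega r (zero_sum_const m G) \<le> Suc N"
  using zero_sum_const_le_matchings[OF assms(1,2)
      binomial_le_matching_capacity[OF assms(3)] assms(4)]
  by (intro Omega_le) simp_all

lemma Omega_le_of_intersecting_dvd:
  assumes "comm_group G" and "forces_zero_sum_copy r (intersecting_families r m) G N"
    and "r > 0" and "m > 0" and "N > 0" and "r dvd N"
  shows "Omega r (zero_sum_const m G) \<le> N"
  using zero_sum_const_le_matchings[OF assms(1,2)
      eq_imp_le[OF binomial_eq_matching_capacity[OF assms(3,6)]] assms(4)] assms(5)
  by (intro Omega_le) simp_all

lemma zero_sum_ramsey_le:
  assumes "d > 0" and "forces_zero_sum_copy r \<F> G d"
  shows "zero_sum_ramsey r \<F> G \<le> d"
  using assms by (simp add: zero_sum_ramsey_def Least_le)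

lemma forces_zero_sum_copy_mono:
  assumes "forces_zero_sum_copy r \<F> G d" and "\<F> \<subseteq> \<F>'"
  shows "forces_zero_sum_copy r \<F>' G d"
  using assms unfolding forces_zero_sum_copy_def by (meson subsetD)

lemma hyperstars_subset_intersecting_families: "hyperstars r m \<subseteq> intersecting_families r m"
  by (auto simp: hyperstars_def intersecting_families_def)

theorem theorem1p1:
  fixes G :: "('a, 'b) monoid_scheme" and k r m n :: nat
  assumes "comm_group G" and "finite (carrier G)"
    and "k \<ge> 1" and "r \<ge> 2"
    and "m = k * group_exponent G"
    and "n = Omega r (zero_sum_const m G)"
  shows "n - 1 \<le> zero_sum_ramsey r (intersecting_families r m) G \<and>
    zero_sum_ramsey r (intersecting_families r m) G \<le> zero_sum_ramsey r (hyperstars r m) G \<and>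
    zero_sum_ramsey r (hyperstars r m) G \<le> n \<and>
    (r dvd n - 1 \<longrightarrow>
      zero_sum_ramsey r (intersecting_families r m) G = n \<and>
      zero_sum_ramsey r (hyperstars r m) G = n)"
    (is "_ \<le> ?R\<^sub>I \<and> _ \<le> ?R\<^sub>S \<and> _")
proof -
  have pos: "r > 0" "m > 0" using assms(3-5) group_exponent_works[OF assms(1,2)] by simp_all
  have R\<^sub>I: "?R\<^sub>I > 0" "forces_zero_sum_copy r (intersecting_families r m) G ?R\<^sub>I"
    and R\<^sub>S: "?R\<^sub>S > 0" "forces_zero_sum_copy r (hyperstars r m) G ?R\<^sub>S"
    using zero_sum_ramsey_works[OF assms(1,2,5,4)] by simp_all
  have mid: "?R\<^sub>I \<le> ?R\<^sub>S"
    using R\<^sub>S forces_zero_sum_copy_mono hyperstars_subset_intersecting_families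
    by (intro zero_sum_ramsey_le) blast+
  have upper: "?R\<^sub>S \<le> n"
    using Omega_works[OF assms(4)] forces_zero_sum_hyperstar[OF assms(1,2,5,4)] assms(6)
    by (intro zero_sum_ramsey_le) simp_all
  have lower: "n \<le> Suc ?R\<^sub>I"
    unfolding assms(6) using assms(1) R\<^sub>I(2) pos by (rule Omega_le_Suc_of_intersecting)
  have lower_dvd: "n \<le> ?R\<^sub>I" if "r dvd ?R\<^sub>I"
    unfolding assms(6) using assms(1) R\<^sub>I(2) pos R\<^sub>I(1) that by (rule Omega_le_of_intersecting_dvd)
  have "n \<le> ?R\<^sub>I" if "r dvd n - 1"
    using lower lower_dvd that by (cases "?R\<^sub>I = n - 1") auto
  then show ?thesis using lower mid upper by auto
qed

end
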